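(* Let $G$ be a Hausdorff topological group. Then the binary $G$-spaces (as objects) and the bi-equivariant maps between them (as morphisms, with the usual composition of maps and the usual identity maps) form a category.
   Context: Let $G$ be a topological group with identity element $e$. A binary action of $G$ on a (Hausdorff) topological space $X$ is a continuous map $\alpha:G\times X^2\to X$ such that $\alpha(gh,t,x)=\alpha(g,t,\alpha(h,t,x))$ and $\alpha(e,t,x)=x$ for all $g,h\in G$ and $t,x\in X$. A binary $G$-space is a triple $(G,X,\alpha)$ consisting of a Hausdorff topological space $X$ with a fixed binary action $\alpha$ of $G$ on $X$. If $(G,X,\alpha)$ and $(G,Y,\beta)$ are binary $G$-spaces, a continuous map $f:X\to Y$ is bi-equivariant if $f(\alpha(g,t,x))=\beta(g,f(t),f(x))$ for all $g\in G$ and $t,x\in X$. *)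

theory Defs
  imports "HOL-Analysis.Analysis" "HOL-Algebra.Group"
begin

locale category =
  fixes Ob :: "'o set"
    and Arr :: "'m set"
    and Dom Cod :: "'m \<Rightarrow> 'o"
    and Idt :: "'o \<Rightarrow> 'm"
    and Cmp :: "'m \<Rightarrow> 'm \<Rightarrow> 'm"
  assumes Dom_in_Ob: "f \<in> Arr \<Longrightarrow> Dom f \<in> Ob"
    and Cod_in_Ob: "f \<in> Arr \<Longrightarrow> Cod f \<in> Ob"
    and Idt_in_Arr: "A \<in> Ob \<Longrightarrow> Idt A \<in> Arr"
    and Dom_Idt: "A \<in> Ob \<Longrightarrow> Dom (Idt A) = A"
    and Cod_Idt: "A \<in> Ob \<Longrightarrow> Cod (Idt A) = A"
    and Cmp_in_Arr: "\<lbrakk>f \<in> Arr; g \<in> Arr; Cod f = Dom g\<rbrakk> \<Longrightarrow> Cmp g f \<in> Arr"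
    and Dom_Cmp: "\<lbrakk>f \<in> Arr; g \<in> Arr; Cod f = Dom g\<rbrakk> \<Longrightarrow> Dom (Cmp g f) = Dom f"
    and Cod_Cmp: "\<lbrakk>f \<in> Arr; g \<in> Arr; Cod f = Dom g\<rbrakk> \<Longrightarrow> Cod (Cmp g f) = Cod g"
    and Cmp_assoc: "\<lbrakk>f \<in> Arr; g \<in> Arr; h \<in> Arr; Cod f = Dom g; Cod g = Dom h\<rbrakk>
      \<Longrightarrow> Cmp h (Cmp g f) = Cmp (Cmp h g) f"
    and Cmp_Idt_right: "f \<in> Arr \<Longrightarrow> Cmp f (Idt (Dom f)) = f"
    and Cmp_Idt_left: "f \<in> Arr \<Longrightarrow> Cmp (Idt (Cod f)) f = f"

locale topological_group = group G for G (structure) +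
  fixes T :: "'g topology"
  assumes topspace_eq_carrier: "topspace T = carrier G"
    and continuous_mult: "continuous_map (prod_topology T T) T (\<lambda>(g, h). g \<otimes> h)"
    and continuous_inv: "continuous_map T T (\<lambda>g. inv g)"

definition binary_action ::
    "('g, 'b) monoid_scheme \<Rightarrow> 'g topology \<Rightarrow> 'x topology \<Rightarrow> ('g \<times> 'x \<times> 'x \<Rightarrow> 'x) \<Rightarrow> bool"
  where
  "binary_action G T X \<alpha> \<longleftrightarrow>
     continuous_map (prod_topology T (prod_topology X X)) X \<alpha> \<and>
     (\<forall>g \<in> carrier G. \<forall>h \<in> carrier G. \<forall>t \<in> topspace X. \<forall>x \<in> topspace X.
        \<alpha> (g \<otimes>\<^bsub>G\<^esub> h, t, x) = \<alpha> (g, t, \<alpha> (h, t, x))) \<and>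
     (\<forall>t \<in> topspace X. \<forall>x \<in> topspace X. \<alpha> (\<one>\<^bsub>G\<^esub>, t, x) = x)"

record ('g, 'x) binary_space =
  space_of :: "'x topology"
  action_of :: "'g \<times> 'x \<times> 'x \<Rightarrow> 'x"

text \<open>The values of the action outside \<open>G \<times> X\<^sup>2\<close> are normalised (\<^const>\<open>extensional\<close>), so that equality
  of records is equality of binary \<open>G\<close>-spaces; likewise for the underlying maps of morphisms
  below. The underlying sets of the spaces are arbitrary subsets of the type \<open>'x\<close>, which
  plays the role of the universe.\<close>

definition binary_G_spaces ::
    "('g, 'b) monoid_scheme \<Rightarrow> 'g topology \<Rightarrow> ('g, 'x) binary_space set"
  where
  "binary_G_spaces G T =
     {A. Hausdorff_space (space_of A) \<and>
         binary_action G T (space_of A) (action_of A) \<and>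
         action_of A \<in>
           extensional (carrier G \<times> topspace (space_of A) \<times> topspace (space_of A))}"

definition bi_equivariant ::
    "('g, 'b) monoid_scheme \<Rightarrow> ('g, 'x) binary_space \<Rightarrow> ('g, 'y) binary_space \<Rightarrow> ('x \<Rightarrow> 'y) \<Rightarrow> bool"
  where
  "bi_equivariant G A B f \<longleftrightarrow>
     continuous_map (space_of A) (space_of B) f \<and>
     (\<forall>g \<in> carrier G. \<forall>t \<in> topspace (space_of A). \<forall>x \<in> topspace (space_of A).
        f (action_of A (g, t, x)) = action_of B (g, f t, f x))"

record ('g, 'x) binary_morphism =
  source :: "('g, 'x) binary_space"
  target :: "('g, 'x) binary_space"
  map_of_mor :: "'x \<Rightarrow> 'x"

definition binary_G_morphisms ::
    "('g, 'b) monoid_scheme \<Rightarrow> 'g topology \<Rightarrow> ('g, 'x) binary_morphism set"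
  where
  "binary_G_morphisms G T =
     {m. source m \<in> binary_G_spaces G T \<and> target m \<in> binary_G_spaces G T \<and>
         bi_equivariant G (source m) (target m) (map_of_mor m) \<and>
         map_of_mor m \<in> extensional (topspace (space_of (source m)))}"

definition id_morphism :: "('g, 'x) binary_space \<Rightarrow> ('g, 'x) binary_morphism" where
  "id_morphism A =
     \<lparr>source = A, target = A, map_of_mor = (\<lambda>x \<in> topspace (space_of A). x)\<rparr>"

definition comp_morphism ::
    "('g, 'x) binary_morphism \<Rightarrow> ('g, 'x) binary_morphism \<Rightarrow> ('g, 'x) binary_morphism"
  where
  "comp_morphism n m =
     \<lparr>source = source m, target = target n,
      map_of_mor = compose (topspace (space_of (source m))) (map_of_mor n) (map_of_mor m)\<rparr>"

end

theory Submission
  imports Defs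
begin

text \<open>
  The category laws are inherited from the category of sets: associativity and the unit laws for
  morphisms hold because they hold for functions, once functions are normalised outside their
  domain. What is specific to binary actions is that the bi-equivariant maps contain the identities
  and are closed under composition. A composite \<open>k \<circ> f\<close> of bi-equivariant maps satisfies
  \<open>k (f (\<alpha> (g, t, x))) = k (\<beta> (g, f t, f x)) = \<gamma> (g, k (f t), k (f x))\<close>,
  where the second step applies the equation for \<open>k\<close> at the points \<open>f t\<close> and \<open>f x\<close>; these lie in
  the middle space since \<open>f\<close> is continuous into it.

  Morphisms carry functions restricted to the underlying set of their source, and an equation for
  such a function at \<open>\<alpha> (g, t, x)\<close> is the one for the unrestricted function only if this point
  lies in that set. That it does is \<open>binary_action_closed\<close>; \<open>bi_equivariant_cong\<close> then
  allows passing between a map and its restriction.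
\<close>

text \<open>
  The continuous map \<open>\<alpha>\<close> has all of \<open>G \<times> X\<^sup>2\<close> as its domain because the topology of \<open>G\<close> lives on
  the whole carrier.
\<close>

lemma binary_action_closed:
  assumes "topological_group G T" and "A \<in> binary_G_spaces G T"
    and "g \<in> carrier G" and "t \<in> topspace (space_of A)" and "x \<in> topspace (space_of A)"
  shows "action_of A (g, t, x) \<in> topspace (space_of A)"
proof -
  have "continuous_map (prod_topology T (prod_topology (space_of A) (space_of A)))
          (space_of A) (action_of A)"
    using assms(2) by (simp add: binary_G_spaces_def binary_action_def)
  moreover have "(g, t, x) \<in> topspace (prod_topology T (prod_topology (space_of A) (space_of A)))"
    using assms by (simp add: topological_group.topspace_eq_carrier)
  ultimately show ?thesis
    by (meson continuous_map_def funcset_mem)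
qed

text \<open>
  Bi-equivariance evaluates a map only at \<open>t\<close>, \<open>x\<close> and \<open>\<alpha> (g, t, x)\<close>, all points of the underlying
  set. So identities and composites may be checked for the plain functions and restricted afterwards.
\<close>

lemma bi_equivariant_cong:
  assumes "topological_group G T" and "A \<in> binary_G_spaces G T"
    and "bi_equivariant G A B f" and "\<And>x. x \<in> topspace (space_of A) \<Longrightarrow> f x = f' x"
  shows "bi_equivariant G A B f'"
  unfolding bi_equivariant_def
proof (intro conjI ballI)
  show "continuous_map (space_of A) (space_of B) f'"
    using assms(3,4) by (auto simp: bi_equivariant_def intro: continuous_map_eq)
next
  fix g t x
  assume g: "g \<in> carrier G" and t: "t \<in> topspace (space_of A)" and x: "x \<in> topspace (space_of A)"
  have "f (action_of A (g, t, x)) = action_of B (g, f t, f x)"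
    using assms(3) g t x by (simp add: bi_equivariant_def)
  then show "f' (action_of A (g, t, x)) = action_of B (g, f' t, f' x)"
    using assms(4) binary_action_closed[OF assms(1,2) g t x] t x by simp
qed

lemma bi_equivariant_id: "bi_equivariant G A A (\<lambda>x. x)"
  by (simp add: bi_equivariant_def)

lemma bi_equivariant_comp:
  assumes f: "bi_equivariant G A B f" and k: "bi_equivariant G B C k"
  shows "bi_equivariant G A C (k \<circ> f)"
proof -
  have "f x \<in> topspace (space_of B)" if "x \<in> topspace (space_of A)" for x
    using f that by (auto simp: bi_equivariant_def continuous_map_def)
  then show ?thesis
    using f k by (auto simp: bi_equivariant_def intro: continuous_map_compose)
qed

lemma id_morphism_in_binary_G_morphisms:
  assumes "topological_group G T" and "A \<in> binary_G_spaces G T"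
  shows "id_morphism A \<in> binary_G_morphisms G T"
proof -
  have "bi_equivariant G A A (\<lambda>x \<in> topspace (space_of A). x)"
    by (rule bi_equivariant_cong[OF assms bi_equivariant_id]) simp
  then show ?thesis
    using assms(2) by (simp add: binary_G_morphisms_def id_morphism_def)
qed

lemma comp_morphism_in_binary_G_morphisms:
  assumes "topological_group G T" and m: "m \<in> binary_G_morphisms G T"
    and n: "n \<in> binary_G_morphisms G T" and "target m = source n"
  shows "comp_morphism n m \<in> binary_G_morphisms G T"
proof -
  have A: "source m \<in> binary_G_spaces G T"
    using m by (simp add: binary_G_morphisms_def)
  have "bi_equivariant G (source m) (target n) (map_of_mor n \<circ> map_of_mor m)"
    using m n assms(4) by (auto simp: binary_G_morphisms_def intro: bi_equivariant_comp)
  then have "bi_equivariant G (source m) (target n)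
      (compose (topspace (space_of (source m))) (map_of_mor n) (map_of_mor m))"
    by (rule bi_equivariant_cong[OF assms(1) A]) (simp add: compose_def)
  then show ?thesis
    using m n by (simp add: binary_G_morphisms_def comp_morphism_def)
qed

lemma map_of_mor_in_topspace:
  assumes "m \<in> binary_G_morphisms G T"
  shows "map_of_mor m \<in> topspace (space_of (source m)) \<rightarrow> topspace (space_of (target m))"
  using assms
  by (auto simp: binary_G_morphisms_def bi_equivariant_def continuous_map_def)

theorem theorem8:
  fixes G :: "('g, 'b) monoid_scheme" and T :: "'g topology"
  assumes "topological_group G T" and "Hausdorff_space T"
  shows "category
           (binary_G_spaces G T :: ('g, 'x) binary_space set)
           (binary_G_morphisms G T)
           source target id_morphism comp_morphism"
proof
  fix f g h :: "('g, 'x) binary_morphism"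
  assume f: "f \<in> binary_G_morphisms G T" and "g \<in> binary_G_morphisms G T"
    and "h \<in> binary_G_morphisms G T"
    and fg: "target f = source g" and "target g = source h"
  show "comp_morphism h (comp_morphism g f) = comp_morphism (comp_morphism h g) f"
    using map_of_mor_in_topspace[OF f] fg
    by (simp add: comp_morphism_def compose_assoc)
next
  fix f :: "('g, 'x) binary_morphism"
  assume f: "f \<in> binary_G_morphisms G T"
  then have ext: "map_of_mor f \<in> extensional (topspace (space_of (source f)))"
    by (simp add: binary_G_morphisms_def)
  show "comp_morphism f (id_morphism (source f)) = f"
    using compose_Id[OF _ ext] map_of_mor_in_topspace[OF f]
    by (simp add: comp_morphism_def id_morphism_def)
  show "comp_morphism (id_morphism (target f)) f = f"
    using Id_compose[OF map_of_mor_in_topspace[OF f] ext]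
    by (simp add: comp_morphism_def id_morphism_def)
next
  fix f g :: "('g, 'x) binary_morphism"
  assume "f \<in> binary_G_morphisms G T" and "g \<in> binary_G_morphisms G T"
    and "target f = source g"
  then show "comp_morphism g f \<in> binary_G_morphisms G T"
    by (rule comp_morphism_in_binary_G_morphisms[OF assms(1)])
next
  fix A :: "('g, 'x) binary_space"
  assume "A \<in> binary_G_spaces G T"
  then show "id_morphism A \<in> binary_G_morphisms G T"
    by (rule id_morphism_in_binary_G_morphisms[OF assms(1)])
qed (auto simp: binary_G_morphisms_def id_morphism_def comp_morphism_def)

end
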